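(* The cardinal $\mathfrak{r}_\rho$ does not depend on $\rho$; that is, $\mathfrak{r}_\rho=\mathfrak{r}_\tau$ for all real numbers $\rho,\tau\in(0,1)$.
   Context: $[\omega]^\omega$ is the set of infinite subsets of $\omega$. For $\rho\in(0,1)$ and $S,X\in[\omega]^\omega$, we say that $S$ $\rho$-splits $X$, written $S\mid_\rho X$, if $\frac{|S\cap X\cap n|}{|X\cap n|}\to\rho$ as $n\to\infty$. The cardinal $\mathfrak{r}_\rho$ is the least size of a family $\mathcal{R}\subseteq[\omega]^\omega$ such that for every $S\in[\omega]^\omega$ there is an $X\in\mathcal{R}$ which is not $\rho$-split by $S$. *)

theory Defs
  imports Complex_Main
begin

unbundle cardinal_syntax

definition infinite_subsets :: "nat set set" where
  "infinite_subsets = {X. infinite X}"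

text \<open>The paper's \<open>n\<close> is the von Neumann ordinal, hence \<open>{..<n}\<close>. The ratio is \<open>0\<close> for the finitely
  many \<open>n\<close> below the least element of \<open>X\<close>, which does not affect the limit.\<close>

definition splits :: "real \<Rightarrow> nat set \<Rightarrow> nat set \<Rightarrow> bool" where
  "splits \<rho> S X \<longleftrightarrow>
     (\<lambda>n. real (card (S \<inter> X \<inter> {..<n})) / real (card (X \<inter> {..<n}))) \<longlonglongrightarrow> \<rho>"

definition unsplit_family :: "real \<Rightarrow> nat set set \<Rightarrow> bool" where
  "unsplit_family \<rho> R \<longleftrightarrow>
     R \<subseteq> infinite_subsets \<and> (\<forall>S\<in>infinite_subsets. \<exists>X\<in>R. \<not> splits \<rho> S X)"

text \<open>A cardinal is represented by a cardinal order, as in the HOL cardinals library; equality of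
  cardinals is therefore order isomorphism \<open>=o\<close>, and the choice of a family of least size is
  immaterial. That such a family exists for \<open>\<rho> < 1\<close> is shown below.\<close>

definition reaping_number :: "real \<Rightarrow> nat set rel" where
  "reaping_number \<rho> =
     |SOME R. unsplit_family \<rho> R \<and> (\<forall>R'. unsplit_family \<rho> R' \<longrightarrow> |R| \<le>o |R'| )|"

lemma not_splits_self:
  assumes "infinite S" "\<rho> < 1"
  shows "\<not> splits \<rho> S S"
proof
  assume "splits \<rho> S S"
  then have lim: "(\<lambda>n. real (card (S \<inter> {..<n})) / real (card (S \<inter> {..<n}))) \<longlonglongrightarrow> \<rho>"
    by (simp add: splits_def)
  obtain a where a: "a \<in> S" using assms(1) by (metis finite.emptyI ex_in_conv)
  have "\<forall>\<^sub>F n in sequentially. real (card (S \<inter> {..<n})) / real (card (S \<inter> {..<n})) = 1"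
    using eventually_gt_at_top[of a]
  proof eventually_elim
    case (elim n)
    then have "a \<in> S \<inter> {..<n}" using a by simp
    then have "card (S \<inter> {..<n}) \<noteq> 0" by (metis card_0_eq empty_iff finite_Int finite_lessThan)
    then show ?case by simp
  qed
  then have "(\<lambda>n. real (card (S \<inter> {..<n})) / real (card (S \<inter> {..<n}))) \<longlonglongrightarrow> 1"
    by (rule tendsto_eventually)
  with lim have "\<rho> = 1" by (rule LIMSEQ_unique)
  with assms(2) show False by simp
qed

lemma least_unsplit_family_exists:
  assumes "\<rho> < 1"
  shows "\<exists>R. unsplit_family \<rho> R \<and> (\<forall>R'. unsplit_family \<rho> R' \<longrightarrow> |R| \<le>o |R'| )"
proof -
  have "unsplit_family \<rho> infinite_subsets"
    using not_splits_self assms by (auto simp: unsplit_family_def infinite_subsets_def)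
  then have "card_of ` {R. unsplit_family \<rho> R} \<noteq> {}" by blast
  moreover have "\<forall>r\<in>card_of ` {R. unsplit_family \<rho> R}. Well_order r"
    using card_of_Well_order by blast
  ultimately show ?thesis
    using exists_minim_Well_order[of "card_of ` {R. unsplit_family \<rho> R}"] by auto
qed

lemma reaping_number_attained:
  assumes "\<rho> < 1"
  shows "\<exists>R. unsplit_family \<rho> R \<and> reaping_number \<rho> = |R|"
  using someI_ex[OF least_unsplit_family_exists[OF assms]] by (auto simp: reaping_number_def)

lemma reaping_number_least:
  assumes "\<rho> < 1" "unsplit_family \<rho> R"
  shows "reaping_number \<rho> \<le>o |R|"
  using someI_ex[OF least_unsplit_family_exists[OF assms(1)]] assms(2)
  by (auto simp: reaping_number_def)

end

theory Submission
  imports Defs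
begin

text \<open>Let \<open>R\<close> be a family such that, for every set \<open>C\<close> which meets all members of \<open>R\<close> in an infinite
  set, some \<open>S\<close> \<open>\<tau>\<close>-splits all \<open>X \<inter> C\<close> with \<open>X \<in> R\<close>. Traces \<open>{X \<inter> C | X \<in> R}\<close> are no larger than
  \<open>R\<close>, so this holds whenever \<open>R\<close> is smaller than the reaping number of \<open>\<tau>\<close>. By bisection one finds
  sets \<open>A\<^sub>k\<close> and \<open>C\<^sub>k\<close> with relative densities \<open>a\<^sub>k\<close> and \<open>d\<^sub>k\<close> in every member of \<open>R\<close>, where
  \<open>a\<^sub>k \<le> \<rho> \<le> a\<^sub>k + d\<^sub>k\<close>: split \<open>C\<^sub>k\<close> in the proportion \<open>\<tau> : 1 - \<tau>\<close>, keep the piece whose interval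
  of densities contains \<open>\<rho>\<close>, and add the other one to \<open>A\<^sub>k\<close> if it lies below. Since \<open>d\<^sub>k\<close> tends to \<open>0\<close>
  and \<open>A\<^sub>k \<subseteq> \<Union>\<^sub>j A\<^sub>j \<subseteq> A\<^sub>k \<union> C\<^sub>k\<close>, the union of the \<open>A\<^sub>k\<close> \<open>\<rho>\<close>-splits every member of \<open>R\<close>.\<close>

lemma filterlim_card_Int_lessThan_at_top:
  fixes X :: "nat set"
  assumes "infinite X"
  shows "filterlim (\<lambda>n. real (card (X \<inter> {..<n}))) at_top sequentially"
proof -
  have "filterlim (\<lambda>n. card (X \<inter> {..<n})) at_top sequentially"
    unfolding filterlim_at_top
  proof
    fix k
    obtain B where B: "B \<subseteq> X" "finite B" "card B = k"
      using infinite_arbitrarily_large[OF assms] by blast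
    obtain m where m: "B \<subseteq> {..<m}"
      using B(2) by (auto simp: finite_nat_set_iff_bounded)
    show "\<forall>\<^sub>F n in sequentially. k \<le> card (X \<inter> {..<n})"
      using eventually_ge_at_top[of m]
    proof eventually_elim
      case (elim n)
      then have "B \<subseteq> X \<inter> {..<n}" using B(1) m by fastforce
      then show ?case using card_mono[of "X \<inter> {..<n}" B] B(3) by simp
    qed
  qed
  then show ?thesis
    by (rule filterlim_compose[OF filterlim_real_sequentially])
qed

text \<open>A finite intersection bounds the numerators, while the denominators tend to infinity, so
  the limit would be \<open>0\<close>.\<close>

lemma infinite_Int_if_splits:
  assumes "splits a A X" "infinite X" "a \<noteq> 0"
  shows "infinite (A \<inter> X)"
proof
  assume fin: "finite (A \<inter> X)"
  have "(\<lambda>n. real (card (A \<inter> X)) / real (card (X \<inter> {..<n}))) \<longlonglongrightarrow> 0"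
    by (rule real_tendsto_divide_at_top[OF tendsto_const
          filterlim_card_Int_lessThan_at_top[OF assms(2)]])
  then have "(\<lambda>n. real (card (A \<inter> X \<inter> {..<n})) / real (card (X \<inter> {..<n}))) \<longlonglongrightarrow> 0"
    by (rule tendsto_sandwich[OF _ _ tendsto_const, rotated 2])
       (auto intro!: always_eventually divide_right_mono card_mono fin)
  with assms(1,3) show False
    unfolding splits_def using LIMSEQ_unique by blast
qed

lemma splits_empty: "splits 0 {} X"
  by (simp add: splits_def)

lemma splits_UNIV:
  assumes "infinite X"
  shows "splits 1 UNIV X"
proof -
  have "\<forall>\<^sub>F n in sequentially. 0 < real (card (X \<inter> {..<n}))"
    using filterlim_card_Int_lessThan_at_top[OF assms] unfolding filterlim_at_top_dense by blast
  then show ?thesis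
    unfolding splits_def by (intro tendsto_eventually) (auto elim!: eventually_mono)
qed

lemma splits_Un:
  assumes "splits a A X" "splits b B X" "A \<inter> B = {}"
  shows "splits (a + b) (A \<union> B) X"
proof -
  have "card ((A \<union> B) \<inter> X \<inter> {..<n}) = card (A \<inter> X \<inter> {..<n}) + card (B \<inter> X \<inter> {..<n})" for n
    using assms(3) by (subst card_Un_disjoint[symmetric]) (auto intro!: arg_cong[of _ _ card])
  then show ?thesis
    using tendsto_add[OF assms(1,2)[unfolded splits_def]]
    by (simp add: splits_def add_divide_distrib)
qed

lemma splits_Diff:
  assumes "splits a A X" "splits b B X" "B \<subseteq> A"
  shows "splits (a - b) (A - B) X"
proof -
  have "card (A \<inter> X \<inter> {..<n}) = card ((A - B) \<inter> X \<inter> {..<n}) + card (B \<inter> X \<inter> {..<n})" for n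
    using assms(3) by (subst card_Un_disjoint[symmetric]) (auto intro!: arg_cong[of _ _ card])
  then show ?thesis
    using tendsto_diff[OF assms(1,2)[unfolded splits_def]]
    by (simp add: splits_def add_divide_distrib)
qed

lemma splits_Int:
  assumes "splits a A X" "splits b B (X \<inter> A)"
  shows "splits (a * b) (A \<inter> B) X"
proof -
  have "real (card (A \<inter> X \<inter> {..<n})) / real (card (X \<inter> {..<n})) *
        (real (card (B \<inter> (X \<inter> A) \<inter> {..<n})) / real (card (X \<inter> A \<inter> {..<n}))) =
        real (card (A \<inter> B \<inter> X \<inter> {..<n})) / real (card (X \<inter> {..<n}))" for n
  proof -
    have "A \<inter> X \<inter> {..<n} = X \<inter> A \<inter> {..<n}" "B \<inter> (X \<inter> A) \<inter> {..<n} = A \<inter> B \<inter> X \<inter> {..<n}"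
      by auto
    \<comment> \<open>This settles the \<open>n\<close> where the cancelled factor
      \<open>card (X \<inter> A \<inter> {..<n})\<close> is \<open>0\<close>: the numerator on the
      right is then \<open>0\<close> as well, and both sides vanish.\<close>
    moreover have "card (A \<inter> B \<inter> X \<inter> {..<n}) \<le> card (X \<inter> A \<inter> {..<n})"
      by (rule card_mono) auto
    ultimately show ?thesis by auto
  qed
  then show ?thesis
    using tendsto_mult[OF assms(1,2)[unfolded splits_def]] by (simp add: splits_def)
qed

text \<open>The bounding sets change with \<open>k\<close>, so no limit in \<open>n\<close> and
  \<open>k\<close> together is available. Each strict bound on the limit needs only one
  \<open>k\<close>, fixed before \<open>n\<close> grows.\<close>

lemma splits_squeeze:
  assumes A: "\<And>k. splits (a k) (A k) X" "\<And>k. A k \<subseteq> S"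
    and B: "\<And>k. splits (b k) (B k) X" "\<And>k. S \<subseteq> B k"
    and lim: "a \<longlonglongrightarrow> \<rho>" "b \<longlonglongrightarrow> \<rho>"
  shows "splits \<rho> S X"
proof -
  have mono: "real (card (U \<inter> X \<inter> {..<n})) / real (card (X \<inter> {..<n})) \<le>
      real (card (V \<inter> X \<inter> {..<n})) / real (card (X \<inter> {..<n}))" if "U \<subseteq> V" for U V n
    using that by (intro divide_right_mono of_nat_mono card_mono) auto
  show ?thesis
    unfolding splits_def
  proof (rule order_tendstoI)
    fix l assume "l < \<rho>"
    then obtain k where "l < a k"
      using order_tendstoD(1)[OF lim(1)] by (auto simp: eventually_sequentially)
    then have "\<forall>\<^sub>F n in sequentially. l < real (card (A k \<inter> X \<inter> {..<n})) / real (card (X \<inter> {..<n}))"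
      using order_tendstoD(1) A(1) unfolding splits_def by blast
    then show "\<forall>\<^sub>F n in sequentially. l < real (card (S \<inter> X \<inter> {..<n})) / real (card (X \<inter> {..<n}))"
      by (rule eventually_mono) (rule less_le_trans[OF _ mono[OF A(2)]])
  next
    fix u assume "\<rho> < u"
    then obtain k where "b k < u"
      using order_tendstoD(2)[OF lim(2)] by (auto simp: eventually_sequentially)
    then have "\<forall>\<^sub>F n in sequentially. real (card (B k \<inter> X \<inter> {..<n})) / real (card (X \<inter> {..<n})) < u"
      using order_tendstoD(2) B(1) unfolding splits_def by blast
    then show "\<forall>\<^sub>F n in sequentially. real (card (S \<inter> X \<inter> {..<n})) / real (card (X \<inter> {..<n})) < u"
      by (rule eventually_mono) (rule le_less_trans[OF mono[OF B(2)]])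
  qed
qed

lemma common_splitting_transfer:
  assumes \<rho>: "0 \<le> \<rho>" "\<rho> \<le> 1" and \<tau>: "0 < \<tau>" "\<tau> < 1"
    and inf: "\<And>X. X \<in> R \<Longrightarrow> infinite X"
    and trace: "\<And>C. (\<And>X. X \<in> R \<Longrightarrow> infinite (X \<inter> C)) \<Longrightarrow> \<exists>S. \<forall>X\<in>R. splits \<tau> S (X \<inter> C)"
  shows "\<exists>S. \<forall>X\<in>R. splits \<rho> S X"
proof -
  \<comment> \<open>A bisection step multiplies \<open>d\<close> by \<open>\<tau>\<close> or by
    \<open>1 - \<tau>\<close>; \<open>m\<close> bounds both factors and gives geometric
    decay.\<close>
  define m where "m = max \<tau> (1 - \<tau>)"
  have m: "\<tau> \<le> m" "1 - \<tau> \<le> m" "0 \<le> m" "m < 1" using \<tau> by (auto simp: m_def)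
  \<comment> \<open>The densities \<open>a\<close> and \<open>d\<close> are common to all members of
    \<open>R\<close>. Keeping \<open>d\<close> positive makes the traces on \<open>C\<close>
    infinite, so that \<open>trace\<close> applies again.\<close>
  define P where "P = (\<lambda>(k::nat) (A :: nat set, a, C, d).
    A \<inter> C = {} \<and> 0 < d \<and> d \<le> m ^ k \<and> a \<le> \<rho> \<and> \<rho> \<le> a + d \<and>
    (\<forall>X\<in>R. splits a A X \<and> splits d C X))"
  \<comment> \<open>The inner approximations grow and the outer ones \<open>A \<union> C\<close>
    shrink.\<close>
  define Q where "Q = (\<lambda>(k::nat) (A :: nat set, a :: real, C :: nat set, d :: real) (A', a' :: real, C', d' :: real).
    A \<subseteq> A' \<and> A' \<union> C' \<subseteq> A \<union> C)"
  have "\<exists>f. \<forall>k. P k (f k) \<and> Q k (f k) (f (Suc k))"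
  proof (rule dependent_nat_choice)
    have "P 0 ({}, 0, UNIV, 1)"
      using \<rho> inf by (simp add: P_def splits_empty splits_UNIV)
    then show "\<exists>x. P 0 x" by blast
  next
    fix x k assume "P k x"
    obtain A a C d where x: "x = (A, a, C, d)" by (metis prod_cases4)
    have disj: "A \<inter> C = {}" and d: "0 < d" "d \<le> m ^ k" and a: "a \<le> \<rho>" "\<rho> \<le> a + d"
      and A: "\<And>X. X \<in> R \<Longrightarrow> splits a A X" and C: "\<And>X. X \<in> R \<Longrightarrow> splits d C X"
      using \<open>P k x\<close> by (auto simp: P_def x)
    have "infinite (X \<inter> C)" if "X \<in> R" for X
      using infinite_Int_if_splits[OF C[OF that] inf[OF that]] d by (simp add: Int_commute)
    from trace[OF this] obtain S where S: "\<And>X. X \<in> R \<Longrightarrow> splits \<tau> S (X \<inter> C)" by blast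
    have inner: "splits (d * \<tau>) (C \<inter> S) X" if "X \<in> R" for X
      using splits_Int[OF C S] that by blast
    show "\<exists>y. P (Suc k) y \<and> Q k x y"
    \<comment> \<open>The point \<open>a + d * \<tau>\<close> cuts the interval from
      \<open>a\<close> to \<open>a + d\<close>; the case decides which part contains
      \<open>\<rho>\<close>.\<close>
    proof (cases "\<rho> \<le> a + d * \<tau>")
      case True
      have "d * \<tau> \<le> m ^ Suc k" using mult_mono[OF d(2) m(1)] m \<tau> by (simp add: mult.commute)
      then have "P (Suc k) (A, a, C \<inter> S, d * \<tau>)"
        using True disj d a \<tau> A inner by (auto simp: P_def)
      moreover have "Q k x (A, a, C \<inter> S, d * \<tau>)" by (auto simp: Q_def x)
      ultimately show ?thesis by blast
    next
      case False
      have "splits (d - d * \<tau>) (C - C \<inter> S) X" if "X \<in> R" for X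
        by (rule splits_Diff[OF C[OF that] inner[OF that]]) auto
      moreover have "splits (a + d * \<tau>) (A \<union> C \<inter> S) X" if "X \<in> R" for X
        using disj by (intro splits_Un A inner that) auto
      moreover have "d - d * \<tau> \<le> m ^ Suc k"
        using mult_mono[OF d(2) m(2)] m \<tau> by (simp add: algebra_simps)
      ultimately have "P (Suc k) (A \<union> C \<inter> S, a + d * \<tau>, C - C \<inter> S, d - d * \<tau>)"
        using False disj d a \<tau> by (auto simp: P_def)
      moreover have "Q k x (A \<union> C \<inter> S, a + d * \<tau>, C - C \<inter> S, d - d * \<tau>)"
        by (auto simp: Q_def x)
      ultimately show ?thesis by blast
    qed
  qed
  then obtain f where f: "\<And>k. P k (f k)" "\<And>k. Q k (f k) (f (Suc k))" by blast
  define A where "A k = fst (f k)" for k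
  define a where "a k = fst (snd (f k))" for k
  define C where "C k = fst (snd (snd (f k)))" for k
  define d where "d k = snd (snd (snd (f k)))" for k
  have fk: "f k = (A k, a k, C k, d k)" for k by (simp add: A_def a_def C_def d_def)
  have disj: "A k \<inter> C k = {}" and d: "0 < d k" "d k \<le> m ^ k" and a: "a k \<le> \<rho>" "\<rho> \<le> a k + d k" for k
    using f(1)[of k] by (auto simp: P_def fk)
  have splits_A: "splits (a k) (A k) X" and splits_C: "splits (d k) (C k) X" if "X \<in> R" for k X
    using f(1)[of k] that by (auto simp: P_def fk)
  have step: "A k \<subseteq> A (Suc k)" "A (Suc k) \<union> C (Suc k) \<subseteq> A k \<union> C k" for k
    using f(2)[of k] by (auto simp: Q_def fk)
  have upper: "\<Union> (range A) \<subseteq> A k \<union> C k" for k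
  proof -
    \<comment> \<open>Earlier stages lie in \<open>A k\<close> by growth; later ones lie in
      \<open>A j \<union> C j\<close>, which has shrunk from
      \<open>A k \<union> C k\<close>.\<close>
    have "A j \<subseteq> A k \<union> C k" for j
    proof (cases "j \<le> k")
      case True
      then show ?thesis using lift_Suc_mono_le[of A, OF step(1)] by blast
    next
      case False
      then show ?thesis
        using lift_Suc_antimono_le[of "\<lambda>k. A k \<union> C k", OF step(2), of k j] by auto
    qed
    then show ?thesis by blast
  qed
  have "(\<lambda>k. m ^ k) \<longlonglongrightarrow> 0" using m by (simp add: LIMSEQ_realpow_zero)
  then have lim_d: "d \<longlonglongrightarrow> 0"
    by (rule tendsto_sandwich[OF _ _ tendsto_const, rotated 2])
       (use d in \<open>auto simp: less_imp_le\<close>)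
  have lim_a: "a \<longlonglongrightarrow> \<rho>"
  proof (rule tendsto_sandwich)
    show "(\<lambda>k. \<rho> - d k) \<longlonglongrightarrow> \<rho>" using tendsto_diff[OF tendsto_const lim_d] by simp
    show "\<forall>\<^sub>F k in sequentially. \<rho> - d k \<le> a k" using a(2) by (simp add: algebra_simps)
  qed (use a in auto)
  have "splits \<rho> (\<Union> (range A)) X" if "X \<in> R" for X
  proof (rule splits_squeeze)
    show "splits (a k) (A k) X" for k by (rule splits_A[OF that])
    show "splits (a k + d k) (A k \<union> C k) X" for k
      by (rule splits_Un[OF splits_A[OF that] splits_C[OF that] disj])
    show "(\<lambda>k. a k + d k) \<longlonglongrightarrow> \<rho>" using tendsto_add[OF lim_a lim_d] by simp
  qed (use upper lim_a in auto)
  then show ?thesis by blast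
qed

lemma reaping_number_le_unsplit_family:
  assumes \<rho>: "0 < \<rho>" "\<rho> < 1" and \<tau>: "0 < \<tau>" "\<tau> < 1" and R: "unsplit_family \<rho> R"
  shows "reaping_number \<tau> \<le>o |R|"
proof (rule ccontr)
  assume not_le: "\<not> reaping_number \<tau> \<le>o |R|"
  have inf: "infinite X" if "X \<in> R" for X
    using R that by (auto simp: unsplit_family_def infinite_subsets_def)
  have "\<exists>S. \<forall>X\<in>R. splits \<tau> S (X \<inter> C)" if C: "\<And>X. X \<in> R \<Longrightarrow> infinite (X \<inter> C)" for C
  proof -
    have "\<not> unsplit_family \<tau> ((\<lambda>X. X \<inter> C) ` R)"
      using reaping_number_least[OF \<tau>(2)] card_of_image not_le ordLeq_transitive by blast
    \<comment> \<open>All traces are infinite, so the trace family can fail to be unsplit only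
      because a single set \<open>\<tau>\<close>-splits every trace.\<close>
    then show ?thesis
      using C by (auto simp: unsplit_family_def infinite_subsets_def)
  qed
  then obtain S where S: "\<And>X. X \<in> R \<Longrightarrow> splits \<rho> S X"
    using common_splitting_transfer[of \<rho> \<tau> R] \<rho> \<tau> inf by (metis less_imp_le)
  \<comment> \<open>Any infinite set serves to show that \<open>R\<close> is nonempty. A member of
    \<open>R\<close> is needed to see that \<open>S\<close> is infinite and hence contradicts the
    choice of \<open>R\<close>.\<close>
  have "UNIV \<in> infinite_subsets" by (simp add: infinite_subsets_def)
  then obtain X where "X \<in> R" using R by (auto simp: unsplit_family_def)
  then have "infinite (S \<inter> X)" using infinite_Int_if_splits[OF S inf] \<rho> by blast
  then have "S \<in> infinite_subsets" by (auto simp: infinite_subsets_def)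
  then show False using R S by (auto simp: unsplit_family_def)
qed

theorem theorem5p3:
  fixes \<rho> \<tau> :: real
  assumes "0 < \<rho>" "\<rho> < 1" "0 < \<tau>" "\<tau> < 1"
  shows "reaping_number \<rho> =o reaping_number \<tau>"
proof -
  have le: "reaping_number \<sigma> \<le>o reaping_number \<sigma>'"
    if "0 < \<sigma>" "\<sigma> < 1" "0 < \<sigma>'" "\<sigma>' < 1" for \<sigma> \<sigma>' :: real
    using reaping_number_attained[of \<sigma>'] reaping_number_le_unsplit_family[of \<sigma>' \<sigma>] that by auto
  show ?thesis
    using le assms by (simp add: ordIso_iff_ordLeq)
qed

end
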